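(* Let $\mathbb{S}$ be a metric space, let $\{P_n\}_{n=1,2,\ldots}$ be a sequence from $\mathbb{P}(\mathbb{S})$ and let $P\in\mathbb{P}(\mathbb{S})$. The following statements are equivalent: (i) $P_n$ converges setwise to $P$; (ii) $\lim_{n\to\infty}P_n(\mathcal{O})=P(\mathcal{O})$ for each open subset $\mathcal{O}\subseteq\mathbb{S}$; (iii) $\lim_{n\to\infty}P_n(C)=P(C)$ for each closed subset $C\subseteq\mathbb{S}$.
   Context: $\mathbb{P}(\mathbb{S})$ is the set of probability measures on $(\mathbb{S},\mathcal{B}(\mathbb{S}))$, where $\mathcal{B}(\mathbb{S})$ is the Borel $\sigma$-field of $\mathbb{S}$. $P_n$ converges setwise to $P$ if $\int_{\mathbb{S}}f\,dP_n\to\int_{\mathbb{S}}f\,dP$ for every bounded Borel-measurable $f:\mathbb{S}\to\mathbb{R}$, equivalently $P_n(E)\to P(E)$ for each $E\in\mathcal{B}(\mathbb{S})$. The space $\mathbb{S}$ is not assumed to be separable or complete. *)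

theory Defs
  imports "HOL-Probability.Probability"
begin

text \<open>The set of Borel probability measures on the space is \<open>space (prob_algebra borel)\<close>, i.e. all
  \<open>M\<close> with \<open>prob_space M\<close> and \<open>sets M = sets borel\<close>.\<close>

definition setwise_converges ::
  "(nat \<Rightarrow> 'a::topological_space measure) \<Rightarrow> 'a measure \<Rightarrow> bool" where
  "setwise_converges Ps P \<longleftrightarrow>
    (\<forall>f::'a \<Rightarrow> real. f \<in> borel_measurable borel \<longrightarrow> bounded (range f) \<longrightarrow>
      (\<lambda>n. integral\<^sup>L (Ps n) f) \<longlonglongrightarrow> integral\<^sup>L P f)"

end

theory Submission
  imports Defs
begin

text \<open>
  The substance of the theorem is that convergence on open sets forces convergence of the integrals
  of all bounded Borel functions. The limit \<open>P\<close> is given as a measure, and every finite Borel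
  measure on a metric space, separable or not, is outer regular: a Borel set \<open>E\<close> lies in an open
  set \<open>U\<close> with \<open>P (U - E)\<close> as small as desired. This is the lemma \<open>closed_open_regular\<close>.

  Regularity of the limit alone suffices. Indeed \<open>P\<^sub>n(E) \<le> P\<^sub>n(U) \<rightarrow> P(U)\<close> shows that
  \<open>limsup P\<^sub>n(E) \<le> P(E)\<close> for every Borel \<open>E\<close>, and the same bound for the complement of
  \<open>E\<close> is \<open>liminf P\<^sub>n(E) \<ge> P(E)\<close>, because all the measures have total mass one. Hence
  \<open>P\<^sub>n(E) \<rightarrow> P(E)\<close>. Convergence on sets passes to bounded measurable functions since these are
  uniform limits of functions with finitely many values, and probability measures integrate a
  uniform error to at most itself. The equivalence of open and closed sets is again the passage to
  complements.
\<close>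

text \<open>
  The sets that are approximable from inside by closed and from outside by open sets form a
  sigma-algebra. It contains each closed set \<open>C\<close> because \<open>C\<close> is the intersection of its open
  \<open>1/n\<close>-neighbourhoods, along which a finite measure is continuous; this is the only use of the
  metric. Two-sided approximation makes the property invariant under complements.
\<close>

lemma closed_open_regular:
  fixes M :: "'a::metric_space measure"
  assumes "finite_measure M" and sets_M: "sets M = sets borel"
    and "E \<in> sets borel" and "e > 0"
  obtains F U where "closed F" "open U" "F \<subseteq> E" "E \<subseteq> U" "measure M (U - F) < e"
proof -
  interpret finite_measure M by fact
  have [measurable]: "A \<in> sets M" if "open A" for A using that sets_M by simp
  have closed_sets [measurable]: "A \<in> sets M" if "closed A" for A using that sets_M by simp
  have "E \<in> sigma_sets UNIV (Collect closed)"
    using \<open>E \<in> sets borel\<close> by (simp add: borel_eq_closed)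
  then have "\<forall>e>0. \<exists>F U. closed F \<and> open U \<and> F \<subseteq> E \<and> E \<subseteq> U \<and> measure M (U - F) < e"
  proof (induction rule: sigma_sets.induct)
    case (Basic C)
    then have C: "closed C" by simp
    define V where "V n = (\<Union>x\<in>C. ball x (1 / Suc n))" for n
    have V: "open (V n)" "C \<subseteq> V n" for n by (auto simp: V_def)
    have "(\<Inter>n. V n) \<subseteq> C"
    proof
      fix y assume y: "y \<in> (\<Inter>n. V n)"
      have "\<exists>x\<in>C. dist x y < d" if d: "d > 0" for d
      proof -
        obtain n where "1 / Suc n < d" using nat_approx_posE[OF d] by blast
        moreover have "y \<in> V n" using y by blast
        ultimately show ?thesis unfolding V_def by (auto intro: less_trans)
      qed
      then show "y \<in> C" using C by (meson closed_approachable)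
    qed
    then have Int_V: "(\<Inter>n. V n) = C" using V(2) by blast
    have "decseq V"
    proof (rule decseq_SucI)
      show "V (Suc n) \<subseteq> V n" for n
        unfolding V_def by (intro UN_mono subset_ball order_refl) (auto simp: field_simps)
    qed
    then have lim: "(\<lambda>n. measure M (V n)) \<longlonglongrightarrow> measure M C"
      using finite_Lim_measure_decseq[of V] V(1) Int_V by fastforce
    show ?case
    proof (intro allI impI)
      fix e :: real assume "e > 0"
      then have "\<forall>\<^sub>F n in sequentially. measure M (V n) < measure M C + e"
        by (intro order_tendstoD(2)[OF lim]) simp
      then obtain n where "measure M (V n) < measure M C + e"
        using eventually_happens trivial_limit_sequentially by blast
      then have "measure M (V n - C) < e"
        using V[of n] C by (subst finite_measure_Diff) auto
      then show "\<exists>F U. closed F \<and> open U \<and> F \<subseteq> C \<and> C \<subseteq> U \<and> measure M (U - F) < e"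
        using C V by blast
    qed
  next
    case Empty
    show ?case by (intro allI impI exI[of _ "{}"] conjI) simp_all
  next
    case (Compl A)
    show ?case
    proof (intro allI impI)
      fix e :: real assume "e > 0"
      with Compl.IH obtain F U
        where "closed F" "open U" "F \<subseteq> A" "A \<subseteq> U" "measure M (U - F) < e"
        by meson
      moreover have "- F - - U = U - F" by blast
      ultimately have "closed (- U) \<and> open (- F) \<and> - U \<subseteq> UNIV - A \<and> UNIV - A \<subseteq> - F \<and>
          measure M (- F - - U) < e" by (auto simp: open_Compl closed_Compl)
      then show "\<exists>F U. closed F \<and> open U \<and> F \<subseteq> UNIV - A \<and> UNIV - A \<subseteq> U \<and> measure M (U - F) < e"
        by (intro exI)
    qed
  next
    case (Union A)
    show ?case
    proof (intro allI impI)
      fix e :: real assume e: "e > 0"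
      define d where "d i = e / 2 * (1 / 2) ^ Suc i" for i :: nat
      have d_pos: "d i > 0" for i using e by (simp add: d_def)
      have d_sums: "d sums (e / 2)"
        using sums_mult[OF power_half_series, of "e / 2"] unfolding d_def by simp
      have "\<exists>F U. closed F \<and> open U \<and> F \<subseteq> A i \<and> A i \<subseteq> U \<and> measure M (U - F) < d i" for i
        using Union.IH d_pos by blast
      then obtain F U where F: "\<And>i. closed (F i)" "\<And>i. F i \<subseteq> A i"
        and U: "\<And>i. open (U i)" "\<And>i. A i \<subseteq> U i"
        and UF: "\<And>i. measure M (U i - F i) < d i" by metis
      have [measurable]: "\<And>i. U i \<in> sets M" "\<And>i. F i \<in> sets M" using F U by auto
      \<comment> \<open>An infinite union of closed sets need not be closed: half of the error pays for all the
        gaps \<open>U i - F i\<close>, the other half for cutting the union of the \<open>F i\<close> at a finite stage.\<close>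
      define G where "G n = (\<Union>i\<le>n. F i)" for n
      have G: "closed (G n)" "G n \<subseteq> (\<Union>i. A i)" for n
        using F by (auto simp: G_def)
      have summ: "summable (\<lambda>i. measure M (U i - F i))"
        by (rule summable_comparison_test'[OF sums_summable[OF d_sums], of 0])
          (simp add: UF less_imp_le)
      have "measure M (\<Union>i. U i - F i) \<le> (\<Sum>i. measure M (U i - F i))"
        by (rule finite_measure_subadditive_countably[OF _ summ]) auto
      also have "\<dots> \<le> suminf d"
        by (rule suminf_le[OF less_imp_le[OF UF] summ sums_summable[OF d_sums]])
      finally have gaps: "measure M (\<Union>i. U i - F i) \<le> e / 2" using d_sums by (simp add: sums_iff)
      have "incseq G" unfolding G_def by (intro incseq_SucI UN_mono) auto
      moreover have "range G \<subseteq> sets M" using G(1) by auto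
      moreover have Un_G: "(\<Union>n. G n) = (\<Union>i. F i)" by (auto simp: G_def)
      ultimately have lim: "(\<lambda>n. measure M (G n)) \<longlonglongrightarrow> measure M (\<Union>i. F i)"
        using finite_Lim_measure_incseq[of G] by simp
      have "\<forall>\<^sub>F n in sequentially. measure M (\<Union>i. F i) - e / 2 < measure M (G n)"
        using e by (intro order_tendstoD(1)[OF lim]) simp
      then obtain n where n: "measure M (\<Union>i. F i) - e / 2 < measure M (G n)"
        using eventually_happens trivial_limit_sequentially by blast
      have "G n \<subseteq> (\<Union>i. F i)" using Un_G by blast
      then have tail: "measure M ((\<Union>i. F i) - G n) < e / 2"
        using n G(1) by (subst finite_measure_Diff) auto
      have "measure M ((\<Union>i. U i) - G n) \<le> measure M ((\<Union>i. U i - F i) \<union> ((\<Union>i. F i) - G n))"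
        using G(1) by (intro finite_measure_mono) auto
      also have "\<dots> \<le> measure M (\<Union>i. U i - F i) + measure M ((\<Union>i. F i) - G n)"
        using G(1) by (intro measure_Un_le) auto
      also have "\<dots> < e" using gaps tail by simp
      finally have "measure M ((\<Union>i. U i) - G n) < e" .
      moreover have "open (\<Union>i. U i)" "(\<Union>i. A i) \<subseteq> (\<Union>i. U i)" using U by auto
      ultimately show "\<exists>F U. closed F \<and> open U \<and> F \<subseteq> \<Union> (range A) \<and> \<Union> (range A) \<subseteq> U \<and> measure M (U - F) < e"
        using G by meson
    qed
  qed
  then show thesis using that \<open>e > 0\<close> by blast
qed

lemma measure_Compl_tendsto:
  fixes Ps :: "'b \<Rightarrow> 'a measure"
  assumes Ps: "\<forall>\<^sub>F n in G. Ps n \<in> space (prob_algebra M)" and P: "P \<in> space (prob_algebra M)"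
    and A: "A \<in> sets M" and lim: "((\<lambda>n. measure (Ps n) A) \<longlongrightarrow> measure P A) G"
  shows "((\<lambda>n. measure (Ps n) (space M - A)) \<longlongrightarrow> measure P (space M - A)) G"
proof -
  have compl: "measure Q (space M - A) = 1 - measure Q A" if "Q \<in> space (prob_algebra M)" for Q
    using that A prob_space.prob_compl[of Q A] sets_eq_imp_space_eq[of Q M]
    by (auto simp: space_prob_algebra)
  have "\<forall>\<^sub>F n in G. 1 - measure (Ps n) A = measure (Ps n) (space M - A)"
    using Ps by eventually_elim (simp add: compl)
  moreover have "((\<lambda>n. 1 - measure (Ps n) A) \<longlongrightarrow> 1 - measure P A) G"
    by (intro tendsto_intros lim)
  ultimately show ?thesis
    using compl[OF P] by (simp add: tendsto_cong)
qed

text \<open>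
  Outer regularity of the limit gives the upper bound for every Borel set, and for the complement
  the upper bound turns into the lower one.
\<close>

lemma measure_tendsto_of_open:
  fixes Ps :: "'b \<Rightarrow> 'a::metric_space measure"
  assumes Ps: "\<forall>\<^sub>F n in G. Ps n \<in> space (prob_algebra borel)"
    and P: "P \<in> space (prob_algebra borel)"
    and lim: "\<And>U. open U \<Longrightarrow> ((\<lambda>n. measure (Ps n) U) \<longlongrightarrow> measure P U) G"
    and E: "E \<in> sets borel"
  shows "((\<lambda>n. measure (Ps n) E) \<longlongrightarrow> measure P E) G"
proof -
  interpret P: prob_space P using P by (simp add: space_prob_algebra)
  have sets_P: "sets P = sets borel" using P by (simp add: space_prob_algebra)
  have upper: "\<forall>\<^sub>F n in G. measure (Ps n) B < a"
    if B: "B \<in> sets borel" and a: "measure P B < a" for B a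
  proof -
    obtain F U where FU: "closed F" "open U" "F \<subseteq> B" "B \<subseteq> U" "measure P (U - F) < a - measure P B"
      using closed_open_regular[OF P.finite_measure_axioms sets_P B, of "a - measure P B"] a by auto
    have "measure P U \<le> measure P (B \<union> (U - F))"
      using FU B sets_P by (intro P.finite_measure_mono) auto
    also have "\<dots> \<le> measure P B + measure P (U - F)"
      using FU B sets_P by (intro measure_Un_le) auto
    also have "\<dots> < a" using FU(5) by simp
    finally have "\<forall>\<^sub>F n in G. measure (Ps n) U < a"
      using order_tendstoD(2)[OF lim[OF FU(2)]] by blast
    with Ps show ?thesis
    proof eventually_elim
      case (elim n)
      interpret prob_space "Ps n" using elim by (simp add: space_prob_algebra)
      have "measure (Ps n) B \<le> measure (Ps n) U"
        using elim FU by (intro finite_measure_mono) (auto simp: space_prob_algebra)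
      then show ?case using elim by simp
    qed
  qed
  have compl: "measure Q (- E) = 1 - measure Q E"
    if "Q \<in> space (prob_algebra borel)" for Q :: "'a measure"
    using that E prob_space.prob_compl[of Q E] sets_eq_imp_space_eq[of Q borel]
    by (auto simp: space_prob_algebra Compl_eq_Diff_UNIV)
  show ?thesis
  proof (rule order_tendstoI)
    fix a assume "a < measure P E"
    then have "\<forall>\<^sub>F n in G. measure (Ps n) (- E) < 1 - a"
      using E by (intro upper) (auto simp: compl[OF P])
    with Ps show "\<forall>\<^sub>F n in G. a < measure (Ps n) E"
      by eventually_elim (simp add: compl)
  qed (use upper[OF E] in auto)
qed

text \<open>
  Rounding a bounded function down to a multiple of \<open>d\<close> leaves finitely many values and
  changes every integral against a probability measure by at most \<open>d\<close>, uniformly in the measure.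
  For the rounded function the integral is a finite combination of measures of sets.
\<close>

lemma integral_tendsto_of_measure:
  fixes Ps :: "'b \<Rightarrow> 'a measure" and f :: "'a \<Rightarrow> real"
  assumes Ps: "\<forall>\<^sub>F n in G. Ps n \<in> space (prob_algebra M)" and P: "P \<in> space (prob_algebra M)"
    and lim: "\<And>E. E \<in> sets M \<Longrightarrow> ((\<lambda>n. measure (Ps n) E) \<longlongrightarrow> measure P E) G"
    and f: "f \<in> borel_measurable M" and bnd: "bounded (range f)"
  shows "((\<lambda>n. integral\<^sup>L (Ps n) f) \<longlongrightarrow> integral\<^sup>L P f) G"
proof (rule tendstoI)
  fix e :: real assume e: "e > 0"
  define d where "d = e / 3"
  have d: "d > 0" using e by (simp add: d_def)
  obtain B where B: "\<And>x. \<bar>f x\<bar> \<le> B" using bnd by (auto simp: bounded_iff)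
  define K where "K = {\<lfloor>- B / d\<rfloor>..\<lfloor>B / d\<rfloor>}"
  define A where "A k = {x \<in> space M. \<lfloor>f x / d\<rfloor> = k}" for k
  have A [measurable]: "A k \<in> sets M" for k
    unfolding A_def using f by measurable
  have K: "\<lfloor>f x / d\<rfloor> \<in> K" for x
  proof -
    have "- B / d \<le> f x / d" "f x / d \<le> B / d"
      using B[of x] d by (auto simp: field_simps abs_le_iff)
    then show ?thesis unfolding K_def by (auto intro: floor_mono)
  qed
  define g where "g x = (\<Sum>k\<in>K. d * of_int k * indicat_real (A k) x)" for x
  have g_eq: "g x = d * of_int \<lfloor>f x / d\<rfloor>" if "x \<in> space M" for x
  proof -
    have "g x = (\<Sum>k\<in>K. if k = \<lfloor>f x / d\<rfloor> then d * of_int k else 0)"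
      unfolding g_def using that by (intro sum.cong) (auto simp: A_def)
    also have "\<dots> = d * of_int \<lfloor>f x / d\<rfloor>" using K[of x] by (simp add: K_def)
    finally show ?thesis .
  qed
  have fg: "\<bar>f x - g x\<bar> \<le> d" if "x \<in> space M" for x
  proof -
    have "d * of_int \<lfloor>f x / d\<rfloor> \<le> d * (f x / d)" "d * (f x / d) \<le> d * (of_int \<lfloor>f x / d\<rfloor> + 1)"
      using d by (intro mult_left_mono; linarith)+
    then show ?thesis using d that by (simp add: g_eq algebra_simps)
  qed
  have close: "\<bar>integral\<^sup>L Q f - (\<Sum>k\<in>K. d * of_int k * measure Q (A k))\<bar> \<le> d"
    if Q: "Q \<in> space (prob_algebra M)" for Q
  proof -
    interpret Q: prob_space Q using Q by (simp add: space_prob_algebra)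
    have sets_Q: "sets Q = sets M" using Q by (simp add: space_prob_algebra)
    then have space_Q: "space Q = space M" by (rule sets_eq_imp_space_eq)
    have f_Q: "f \<in> borel_measurable Q" using f measurable_cong_sets[OF sets_Q refl] by blast
    have A_Q: "A k \<in> sets Q" for k using A sets_Q by simp
    have int_f: "integrable Q f"
      using f_Q B by (intro Q.integrable_const_bound[of _ B]) auto
    have int_A: "integrable Q (\<lambda>x. d * of_int k * indicat_real (A k) x)" for k
      using A_Q by (intro integrable_mult_right) (simp add: less_top[symmetric])
    have int_g: "integrable Q g" unfolding g_def by (intro Bochner_Integration.integrable_sum int_A)
    have "integral\<^sup>L Q g = (\<Sum>k\<in>K. d * of_int k * measure Q (A k))"
      unfolding g_def using int_A A_Q
      by (subst Bochner_Integration.integral_sum) (auto simp: sets.Int_space_eq2)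
    moreover have "\<bar>integral\<^sup>L Q f - integral\<^sup>L Q g\<bar> \<le> d"
    proof -
      have "\<bar>integral\<^sup>L Q f - integral\<^sup>L Q g\<bar> = \<bar>\<integral>x. f x - g x \<partial>Q\<bar>"
        using int_f int_g by simp
      also have "\<dots> \<le> (\<integral>x. \<bar>f x - g x\<bar> \<partial>Q)" by (rule integral_abs_bound)
      also have "\<dots> \<le> (\<integral>x. d \<partial>Q)"
        using int_f int_g fg space_Q by (intro integral_mono) auto
      finally show ?thesis by (simp add: Q.prob_space)
    qed
    ultimately show ?thesis by simp
  qed
  have "((\<lambda>n. \<Sum>k\<in>K. d * of_int k * measure (Ps n) (A k)) \<longlongrightarrow>
      (\<Sum>k\<in>K. d * of_int k * measure P (A k))) G"
    by (intro tendsto_intros lim A)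
  from tendstoD[OF this d] Ps
  show "\<forall>\<^sub>F n in G. dist (integral\<^sup>L (Ps n) f) (integral\<^sup>L P f) < e"
  proof eventually_elim
    case (elim n)
    then show ?case using close[OF P] close[of "Ps n"] unfolding dist_real_def d_def by linarith
  qed
qed

theorem theorem2p3:
  fixes Ps :: "nat \<Rightarrow> 'a::metric_space measure" and P :: "'a measure"
  assumes "\<And>n. n \<ge> 1 \<Longrightarrow> Ps n \<in> space (prob_algebra borel)"
    and "P \<in> space (prob_algebra borel)"
  shows "(setwise_converges Ps P \<longleftrightarrow> (\<forall>U. open U \<longrightarrow> (\<lambda>n. measure (Ps n) U) \<longlonglongrightarrow> measure P U)) \<and>
    ((\<forall>U. open U \<longrightarrow> (\<lambda>n. measure (Ps n) U) \<longlonglongrightarrow> measure P U) \<longleftrightarrow>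
      (\<forall>C. closed C \<longrightarrow> (\<lambda>n. measure (Ps n) C) \<longlonglongrightarrow> measure P C))"
proof -
  have Ps: "\<forall>\<^sub>F n in sequentially. Ps n \<in> space (prob_algebra borel)"
    using assms(1) eventually_sequentially by blast
  note compl = measure_Compl_tendsto[OF Ps assms(2), unfolded space_borel, folded Compl_eq_Diff_UNIV]
  have set_open: "(\<lambda>n. measure (Ps n) U) \<longlonglongrightarrow> measure P U"
    if conv: "setwise_converges Ps P" and U: "open U" for U
  proof -
    have int: "integral\<^sup>L Q (indicat_real U) = measure Q U"
      if "Q \<in> space (prob_algebra borel)" for Q
      using that U sets_eq_imp_space_eq[of Q borel] by (simp add: space_prob_algebra)
    have "bounded (range (indicat_real U))"
      by (rule boundedI[of _ 1]) (auto simp: indicator_def)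
    moreover have "indicat_real U \<in> borel_measurable borel" using U by simp
    ultimately have "(\<lambda>n. integral\<^sup>L (Ps n) (indicat_real U)) \<longlonglongrightarrow> integral\<^sup>L P (indicat_real U)"
      using conv unfolding setwise_converges_def by blast
    moreover have "\<forall>\<^sub>F n in sequentially. integral\<^sup>L (Ps n) (indicat_real U) = measure (Ps n) U"
      using Ps by eventually_elim (rule int)
    ultimately show ?thesis using int[OF assms(2)] by (simp add: tendsto_cong)
  qed
  have open_set: "setwise_converges Ps P"
    if lim: "\<forall>U. open U \<longrightarrow> (\<lambda>n. measure (Ps n) U) \<longlonglongrightarrow> measure P U"
    unfolding setwise_converges_def
    using measure_tendsto_of_open[OF Ps assms(2)] lim
    by (intro allI impI integral_tendsto_of_measure[OF Ps assms(2)]) auto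
  have open_closed: "(\<lambda>n. measure (Ps n) C) \<longlonglongrightarrow> measure P C"
    if "\<forall>U. open U \<longrightarrow> (\<lambda>n. measure (Ps n) U) \<longlonglongrightarrow> measure P U" "closed C" for C
    using that compl[of "- C"] by (simp add: open_Compl)
  have closed_open: "(\<lambda>n. measure (Ps n) U) \<longlonglongrightarrow> measure P U"
    if "\<forall>C. closed C \<longrightarrow> (\<lambda>n. measure (Ps n) C) \<longlonglongrightarrow> measure P C" "open U" for U
    using that compl[of "- U"] by (simp add: closed_Compl)
  show ?thesis
    by (intro conjI iffI allI impI) (rule set_open open_set open_closed closed_open; assumption)+
qed

end
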